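(* Let $P(\mathbf{x})=\sum_\alpha c_\alpha\mathbf{x}^\alpha\in\mathbb{Z}[x_1,\ldots,x_n]$ be a polynomial with no constant term. Suppose there exists a prime $p$ such that: (1) the congruence $\sum_\alpha c_\alpha z^{|\alpha|}\equiv0\pmod p$ has no solution $z\not\equiv0\pmod p$; (2) for every Rado set $J$ of minimal indexes of $P$, the congruence $\sum_{\alpha\in J}c_\alpha z^{|\alpha|}\equiv0\pmod p$ has no solution $z\not\equiv0\pmod p$. Then $P$ is not partition regular on $\mathbb{N}$ except possibly for constant solutions; i.e., there is a finite partition of $\mathbb{N}$ none of whose pieces contains $a_1,\ldots,a_n$, not all equal, with $P(a_1,\ldots,a_n)=0$.
   Context: $\mathbb{N}$ is the set of positive integers. Multi-indexes are $\alpha=(\alpha_1,\ldots,\alpha_n)\in\mathbb{N}_0^n$, $\mathbf{x}^\alpha=\prod_i x_i^{\alpha_i}$, $|\alpha|=\sum_i\alpha_i$; $\alpha\le\beta$ means $\alpha_i\le\beta_i$ for all $i$, and $\alpha<\beta$ means $\alpha\le\beta$, $\alpha\ne\beta$. $\mathrm{supp}(P)=\{\alpha\mid c_\alpha\ne0\}$. An index $\alpha\in\mathrm{supp}(P)$ is minimal if there is no $\beta\in\mathrm{supp}(P)$ with $\beta<\alpha$. A nonempty $J\subseteq\mathrm{supp}(P)$ is a Rado set of indexes if for all $\alpha,\beta\in J$ there is a nonempty $\Lambda\subseteq\{1,\ldots,n\}$ with $\sum_{i\in\Lambda}\alpha_i=\sum_{i\in\Lambda}\beta_i$. A Rado set of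 minimal indexes is a Rado set consisting of minimal indexes. *)

theory Defs
  imports
    "HOL-Library.Poly_Mapping"
    "HOL-Library.Disjoint_Sets"
    "HOL-Number_Theory.Cong"
begin

text \<open>
  The variables are indexed by a finite type \<open>'n\<close> (so the number of variables is
  \<open>CARD('n)\<close>), multi-indexes are elements of \<open>'n \<Rightarrow>\<^sub>0 nat\<close>, and the polynomial ring
  over the integers is the monoid ring \<open>('n \<Rightarrow>\<^sub>0 nat) \<Rightarrow>\<^sub>0 int\<close>; thus the coefficient
  \<open>c\<^sub>\<alpha>\<close> of \<open>P\<close> is \<open>Poly_Mapping.lookup P \<alpha>\<close> and the support of \<open>P\<close> is \<open>Poly_Mapping.keys P\<close>.
\<close>

type_synonym 'n multi_index = "'n \<Rightarrow>\<^sub>0 nat"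
type_synonym 'n int_mpoly = "'n multi_index \<Rightarrow>\<^sub>0 int"

definition total_degree :: "'n::finite multi_index \<Rightarrow> nat"
  where "total_degree \<alpha> = (\<Sum>i\<in>UNIV. Poly_Mapping.lookup \<alpha> i)"

definition eval_mpoly :: "'n::finite int_mpoly \<Rightarrow> ('n \<Rightarrow> int) \<Rightarrow> int"
  where "eval_mpoly P a =
    (\<Sum>\<alpha>\<in>Poly_Mapping.keys P. Poly_Mapping.lookup P \<alpha> *
      (\<Prod>i\<in>UNIV. a i ^ Poly_Mapping.lookup \<alpha> i))"

text \<open>
  The componentwise order. It is not the order that the library puts on
  \<open>'n \<Rightarrow>\<^sub>0 nat\<close>, which is lexicographic.
\<close>

definition index_le :: "'n multi_index \<Rightarrow> 'n multi_index \<Rightarrow> bool"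
  where "index_le \<alpha> \<beta> \<longleftrightarrow> (\<forall>i. Poly_Mapping.lookup \<alpha> i \<le> Poly_Mapping.lookup \<beta> i)"

definition index_less :: "'n multi_index \<Rightarrow> 'n multi_index \<Rightarrow> bool"
  where "index_less \<alpha> \<beta> \<longleftrightarrow> index_le \<alpha> \<beta> \<and> \<alpha> \<noteq> \<beta>"

definition minimal_index :: "'n int_mpoly \<Rightarrow> 'n multi_index \<Rightarrow> bool"
  where "minimal_index P \<alpha> \<longleftrightarrow> \<alpha> \<in> Poly_Mapping.keys P \<and>
    \<not> (\<exists>\<beta>\<in>Poly_Mapping.keys P. index_less \<beta> \<alpha>)"

definition Rado_set :: "'n::finite int_mpoly \<Rightarrow> 'n multi_index set \<Rightarrow> bool"
  where "Rado_set P J \<longleftrightarrow> J \<noteq> {} \<and> J \<subseteq> Poly_Mapping.keys P \<and>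
    (\<forall>\<alpha>\<in>J. \<forall>\<beta>\<in>J. \<exists>\<Lambda>. \<Lambda> \<noteq> {} \<and>
      (\<Sum>i\<in>\<Lambda>. Poly_Mapping.lookup \<alpha> i) = (\<Sum>i\<in>\<Lambda>. Poly_Mapping.lookup \<beta> i))"

definition minimal_Rado_set :: "'n::finite int_mpoly \<Rightarrow> 'n multi_index set \<Rightarrow> bool"
  where "minimal_Rado_set P J \<longleftrightarrow> Rado_set P J \<and> (\<forall>\<alpha>\<in>J. minimal_index P \<alpha>)"

end

theory Submission
  imports Defs
begin

text \<open>
  Write a positive integer as \<open>p ^ v * u\<close> with \<open>p\<close> not dividing \<open>u\<close>, and colour it by
  \<open>u mod p\<close>, by whether \<open>v = 0\<close>, and by the last nonzero digit of \<open>v\<close> in a large prime base \<open>q\<close>.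
  Let \<open>a\<close> be a monochromatic zero of \<open>P\<close>, with valuations \<open>v i\<close> and common last nonzero digit \<open>z\<close>.
  If all \<open>v i\<close> vanish, reducing modulo \<open>p\<close> contradicts the first hypothesis. Otherwise all
  \<open>v i\<close> are positive, and the terms of least \<open>p\<close>-adic weight \<open>\<Sum>i. v i * \<alpha> i\<close> form a set \<open>J\<close>
  of minimal indexes whose terms at \<open>z\<close> sum to \<open>0\<close> modulo \<open>p\<close>. Two indexes of \<open>J\<close> give a linear
  relation \<open>\<Sum>i. (\<alpha> i - \<beta> i) * v i = 0\<close>; by Rado's argument in base \<open>q\<close>, the coefficients at the
  least \<open>q\<close>-adic valuation sum to \<open>0\<close>. Hence \<open>J\<close> is a Rado set, against the second hypothesis.
\<close>

text \<open>For prime \<open>p\<close> and positive \<open>n\<close> this is the lowest nonzero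
  base-\<open>p\<close> digit. Since \<open>multiplicity p 0 = 0\<close>, the value at
  \<open>n = 0\<close> is 0, which makes the digit of a vanishing valuation a harmless
  default.\<close>

definition last_digit :: "nat \<Rightarrow> nat \<Rightarrow> nat"
  where "last_digit p n = n div p ^ multiplicity p n mod p"

text \<open>Divide the vanishing sum by \<open>p ^ d\<close>, where \<open>d\<close> is the least
  weight: each term of larger weight keeps a factor \<open>p\<close> and drops out modulo
  \<open>p\<close>. This serves twice, for the monomials of \<open>P\<close> in base
  \<open>p\<close> and for the valuations in base \<open>q\<close>.\<close>

lemma leading_terms_cong:
  fixes c m \<mu> :: "'a \<Rightarrow> int" and w :: "'a \<Rightarrow> nat" and p :: int
  assumes "finite A" and "p \<noteq> 0"
    and zero: "(\<Sum>x\<in>A. c x * (p ^ w x * m x)) = 0"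
    and cong: "\<And>x. x \<in> A \<Longrightarrow> [m x = \<mu> x] (mod p)"
  shows "[(\<Sum>x | x \<in> A \<and> (\<forall>y\<in>A. w x \<le> w y). c x * \<mu> x) = 0] (mod p)"
proof (cases "A = {}")
  case False
  define d where "d = Min (w ` A)"
  have d_le: "d \<le> w x" if "x \<in> A" for x
    using that \<open>finite A\<close> by (simp add: d_def)
  have "d \<in> w ` A"
    using False \<open>finite A\<close> by (simp add: d_def)
  then have J: "{x. x \<in> A \<and> (\<forall>y\<in>A. w x \<le> w y)} = {x \<in> A. w x = d}"
    using d_le by (auto intro: le_antisym)
  have "(\<Sum>x\<in>A. c x * (p ^ w x * m x)) = p ^ d * (\<Sum>x\<in>A. c x * (p ^ (w x - d) * m x))"
    unfolding sum_distrib_left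
  proof (rule sum.cong)
    fix x assume "x \<in> A"
    then have "p ^ w x = p ^ d * p ^ (w x - d)"
      using d_le by (simp flip: power_add)
    then show "c x * (p ^ w x * m x) = p ^ d * (c x * (p ^ (w x - d) * m x))"
      by (simp add: algebra_simps)
  qed simp
  then have *: "(\<Sum>x\<in>A. c x * (p ^ (w x - d) * m x)) = 0"
    using zero \<open>p \<noteq> 0\<close> by simp
  have "[(\<Sum>x\<in>A. if w x = d then c x * \<mu> x else 0) = (\<Sum>x\<in>A. c x * (p ^ (w x - d) * m x))] (mod p)"
  proof (rule cong_sum)
    fix x assume x: "x \<in> A"
    show "[(if w x = d then c x * \<mu> x else 0) = c x * (p ^ (w x - d) * m x)] (mod p)"
    proof (cases "w x = d")
      case True
      then show ?thesis
        using cong[OF x] by (simp add: cong_scalar_left cong_sym)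
    next
      case False
      then have "p dvd p ^ (w x - d)"
        using d_le[OF x] by (intro dvd_power) auto
      then have "p dvd c x * (p ^ (w x - d) * m x)"
        by simp
      then show ?thesis
        using False by (simp add: cong_0_iff cong_sym)
    qed
  qed
  then show ?thesis
    using \<open>finite A\<close> by (simp add: J * sum.inter_filter)
qed simp

lemma last_digit_cong:
  "[int (n div p ^ multiplicity p n) = int (last_digit p n)] (mod int p)"
  by (simp add: last_digit_def zmod_int cong_def)

lemma decompose_multiplicity:
  "int n = int p ^ multiplicity p n * int (n div p ^ multiplicity p n)"
  by (metis dvd_mult_div_cancel multiplicity_dvd of_nat_mult of_nat_power)

lemma last_digit_not_cong_0:
  assumes "prime p" and "0 < n"
  shows "\<not> [int (last_digit p n) = 0] (mod int p)"
proof -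
  have "\<not> p dvd n div p ^ multiplicity p n"
    using assms by (intro multiplicity_decompose) (auto simp: prime_gt_0_nat dest: prime_gt_1_nat)
  then show ?thesis
    by (simp add: last_digit_def cong_0_iff dvd_mod_iff)
qed

text \<open>Modulo \<open>q\<close>, only the \<open>v i\<close> of least \<open>q\<close>-adic
  valuation survive in the linear relation, all with the same unit \<open>u\<close>. Cancelling
  \<open>u\<close> leaves a congruence between two sums below \<open>q\<close>, hence an
  equality.\<close>

lemma Rado_relation:
  fixes \<alpha> \<beta> v :: "'n::finite \<Rightarrow> nat"
  assumes "prime q" and pos: "\<And>i. 0 < v i"
    and digit: "\<And>i j. last_digit q (v i) = last_digit q (v j)"
    and small: "(\<Sum>i\<in>UNIV. \<alpha> i) < q" "(\<Sum>i\<in>UNIV. \<beta> i) < q"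
    and eq: "(\<Sum>i\<in>UNIV. v i * \<alpha> i) = (\<Sum>i\<in>UNIV. v i * \<beta> i)"
  shows "\<exists>\<Lambda>. \<Lambda> \<noteq> {} \<and> (\<Sum>i\<in>\<Lambda>. \<alpha> i) = (\<Sum>i\<in>\<Lambda>. \<beta> i)"
proof -
  define w where "w i = multiplicity q (v i)" for i
  \<comment> \<open>The index \<open>undefined\<close> is an arbitrary one; by \<open>digit\<close>
    the choice is immaterial.\<close>
  define u where "u = last_digit q (v undefined)"
  define \<Lambda> where "\<Lambda> = {i. i \<in> UNIV \<and> (\<forall>j\<in>UNIV. w i \<le> w j)}"
  have "(\<Sum>i\<in>UNIV. int (v i) * int (\<alpha> i)) = (\<Sum>i\<in>UNIV. int (v i) * int (\<beta> i))"
    using arg_cong[OF eq, of int] by simp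
  then have "(\<Sum>i\<in>UNIV. (int (\<alpha> i) - int (\<beta> i)) * int (v i)) = 0"
    by (simp add: algebra_simps sum_subtractf)
  then have "(\<Sum>i\<in>UNIV. (int (\<alpha> i) - int (\<beta> i)) * (int q ^ w i * int (v i div q ^ w i))) = 0"
    unfolding w_def by (simp flip: decompose_multiplicity)
  then have "[(\<Sum>i\<in>\<Lambda>. (int (\<alpha> i) - int (\<beta> i)) * int u) = 0] (mod int q)"
    unfolding \<Lambda>_def
  proof (intro leading_terms_cong[where p = "int q"])
    show "[int (v i div q ^ w i) = int u] (mod int q)" for i
      using last_digit_cong[of "v i" q] digit[of i undefined] by (simp add: w_def u_def)
  qed (use \<open>prime q\<close> in \<open>auto simp: prime_gt_0_nat\<close>)
  then have "int q dvd (\<Sum>i\<in>\<Lambda>. int (\<alpha> i) - int (\<beta> i)) * int u"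
    by (simp add: cong_0_iff flip: sum_distrib_right)
  moreover have "\<not> int q dvd int u"
    using last_digit_not_cong_0[OF \<open>prime q\<close> pos] by (simp add: u_def cong_0_iff)
  ultimately have "int q dvd int (\<Sum>i\<in>\<Lambda>. \<alpha> i) - int (\<Sum>i\<in>\<Lambda>. \<beta> i)"
    using \<open>prime q\<close> by (simp add: prime_dvd_mult_iff sum_subtractf)
  then have "[(\<Sum>i\<in>\<Lambda>. \<alpha> i) = (\<Sum>i\<in>\<Lambda>. \<beta> i)] (mod q)"
    by (simp only: cong_iff_dvd_diff flip: cong_int_iff)
  moreover have "(\<Sum>i\<in>\<Lambda>. \<alpha> i) < q" "(\<Sum>i\<in>\<Lambda>. \<beta> i) < q"
    by (rule le_less_trans[OF sum_mono2 small(1)] le_less_trans[OF sum_mono2 small(2)]; simp)+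
  ultimately have "(\<Sum>i\<in>\<Lambda>. \<alpha> i) = (\<Sum>i\<in>\<Lambda>. \<beta> i)"
    by (simp add: cong_def)
  moreover have "\<Lambda> \<noteq> {}"
  proof -
    have "Min (range w) \<in> range w"
      by simp
    then obtain i where "w i = Min (range w)"
      by force
    then have "i \<in> \<Lambda>"
      by (simp add: \<Lambda>_def)
    then show ?thesis
      by blast
  qed
  ultimately show ?thesis
    by blast
qed

lemma finite_colouring_partition:
  fixes f :: "'a \<Rightarrow> 'b"
  assumes "finite (f ` A)"
  obtains \<C> where "finite \<C>" "partition_on A \<C>" "\<And>C x y. C \<in> \<C> \<Longrightarrow> x \<in> C \<Longrightarrow> y \<in> C \<Longrightarrow> f x = f y"
proof
  let ?\<C> = "(\<lambda>k. {x \<in> A. f x = k}) ` f ` A"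
  show "finite ?\<C>"
    using assms by blast
  show "partition_on A ?\<C>"
    by (rule partition_onI) (auto simp: disjnt_def)
  show "f x = f y" if "C \<in> ?\<C>" "x \<in> C" "y \<in> C" for C x y
    using that by auto
qed

text \<open>Positive weights turn strictness in one coordinate into strictness of the sum. This
  forces indexes of least weight to be minimal.\<close>

lemma index_less_weighted_sum:
  fixes \<alpha> \<beta> :: "'n::finite multi_index"
  assumes "index_less \<beta> \<alpha>" and pos: "\<And>i. 0 < v i"
  shows "(\<Sum>i\<in>UNIV. v i * Poly_Mapping.lookup \<beta> i) < (\<Sum>i\<in>UNIV. v i * Poly_Mapping.lookup \<alpha> i)"
proof (rule sum_strict_mono_ex1)
  show "\<forall>i\<in>UNIV. v i * Poly_Mapping.lookup \<beta> i \<le> v i * Poly_Mapping.lookup \<alpha> i"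
    using assms by (simp add: index_less_def index_le_def)
  obtain i where "Poly_Mapping.lookup \<beta> i \<noteq> Poly_Mapping.lookup \<alpha> i"
    using assms by (auto simp: index_less_def poly_mapping_eq_iff fun_eq_iff)
  then have "Poly_Mapping.lookup \<beta> i < Poly_Mapping.lookup \<alpha> i"
    using assms by (auto simp: index_less_def index_le_def le_neq_implies_less)
  then show "\<exists>i\<in>UNIV. v i * Poly_Mapping.lookup \<beta> i < v i * Poly_Mapping.lookup \<alpha> i"
    using pos by auto
qed simp

text \<open>Pulling the power of \<open>p\<close> out of each \<open>a i\<close> writes the monomial
  of \<alpha> as \<open>p ^ w \<alpha>\<close> times a product of cofactors. Each cofactor is
  congruent to \<open>z\<close>, so the product is congruent to \<open>z\<close> to the total
  degree.\<close>

lemma eval_mpoly_leading_terms: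
  fixes P :: "'n::finite int_mpoly" and a :: "'n \<Rightarrow> nat"
  assumes "p \<noteq> 0" and digit: "\<And>i. last_digit p (a i) = z"
    and zero: "eval_mpoly P (\<lambda>i. int (a i)) = 0"
  defines "w \<equiv> \<lambda>\<alpha>. \<Sum>i\<in>UNIV. multiplicity p (a i) * Poly_Mapping.lookup \<alpha> i"
  shows "[(\<Sum>\<alpha> | \<alpha> \<in> Poly_Mapping.keys P \<and> (\<forall>\<beta>\<in>Poly_Mapping.keys P. w \<alpha> \<le> w \<beta>).
    Poly_Mapping.lookup P \<alpha> * int z ^ total_degree \<alpha>) = 0] (mod int p)"
proof (rule leading_terms_cong)
  define u where "u i = int (a i div p ^ multiplicity p (a i))" for i
  have "(\<Prod>i\<in>UNIV. int (a i) ^ Poly_Mapping.lookup \<alpha> i)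
      = int p ^ w \<alpha> * (\<Prod>i\<in>UNIV. u i ^ Poly_Mapping.lookup \<alpha> i)" for \<alpha>
  proof -
    have "int (a i) ^ Poly_Mapping.lookup \<alpha> i = int p ^ (multiplicity p (a i) * Poly_Mapping.lookup \<alpha> i)
        * u i ^ Poly_Mapping.lookup \<alpha> i" for i
      by (subst decompose_multiplicity[of "a i" p]) (simp only: u_def power_mult_distrib power_mult)
    then show ?thesis
      by (simp add: w_def prod.distrib power_sum)
  qed
  then show "(\<Sum>\<alpha>\<in>Poly_Mapping.keys P. Poly_Mapping.lookup P \<alpha>
      * (int p ^ w \<alpha> * (\<Prod>i\<in>UNIV. u i ^ Poly_Mapping.lookup \<alpha> i))) = 0"
    using zero by (simp add: eval_mpoly_def)
  show "[(\<Prod>i\<in>UNIV. u i ^ Poly_Mapping.lookup \<alpha> i) = int z ^ total_degree \<alpha>] (mod int p)" for \<alpha>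
  proof -
    have "[u i = int z] (mod int p)" for i
      using last_digit_cong[of "a i" p] digit by (simp add: u_def)
    then show ?thesis
      unfolding total_degree_def power_sum by (intro cong_prod cong_pow)
  qed
qed (use \<open>p \<noteq> 0\<close> in auto)

theorem theorem3p6:
  fixes P :: "'n::finite int_mpoly" and p :: nat
  assumes no_constant_term: "Poly_Mapping.lookup P 0 = 0"
    and prime: "prime p"
    and cond1: "\<not> (\<exists>z::int. \<not> [z = 0] (mod int p) \<and>
      [(\<Sum>\<alpha>\<in>Poly_Mapping.keys P. Poly_Mapping.lookup P \<alpha> * z ^ total_degree \<alpha>) = 0] (mod int p))"
    and cond2: "\<And>J. minimal_Rado_set P J \<Longrightarrow>
      \<not> (\<exists>z::int. \<not> [z = 0] (mod int p) \<and>
        [(\<Sum>\<alpha>\<in>J. Poly_Mapping.lookup P \<alpha> * z ^ total_degree \<alpha>) = 0] (mod int p))"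
  shows "\<exists>\<C>::nat set set. finite \<C> \<and> partition_on {n. 0 < n} \<C> \<and>
    \<not> (\<exists>C\<in>\<C>. \<exists>a::'n \<Rightarrow> nat. (\<forall>i. a i \<in> C) \<and> (\<exists>i j. a i \<noteq> a j) \<and>
        eval_mpoly P (\<lambda>i. int (a i)) = 0)"
proof -
  let ?K = "Poly_Mapping.keys P"
  \<comment> \<open>A bound on the sum of all total degrees bounds each of them. It involves
    \<open>P\<close> alone, so the colouring can be fixed before any zero is considered.\<close>
  obtain q where q: "prime q" and large: "(\<Sum>\<alpha>\<in>?K. total_degree \<alpha>) < q"
    using bigger_prime by blast
  have small: "(\<Sum>i\<in>UNIV. Poly_Mapping.lookup \<alpha> i) < q" if "\<alpha> \<in> ?K" for \<alpha>
    using member_le_sum[of \<alpha> ?K total_degree] that large by (simp add: total_degree_def)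
  define colour where
    "colour n = (last_digit p n, multiplicity p n = 0, last_digit q (multiplicity p n))" for n
  have "colour ` {n. 0 < n} \<subseteq> {..<p} \<times> UNIV \<times> {..<q}"
    using prime q by (auto simp: colour_def last_digit_def prime_gt_0_nat)
  then have "finite (colour ` {n. 0 < n})"
    by (rule finite_subset) simp
  then obtain \<C> where \<C>: "finite \<C>" "partition_on {n. 0 < n} \<C>"
    and mono: "\<And>C x y. C \<in> \<C> \<Longrightarrow> x \<in> C \<Longrightarrow> y \<in> C \<Longrightarrow> colour x = colour y"
    by (rule finite_colouring_partition) blast
  have False if "C \<in> \<C>" and a: "\<And>i. a i \<in> C" and zero: "eval_mpoly P (\<lambda>i. int (a i)) = 0"
    for C and a :: "'n \<Rightarrow> nat"
  proof -
    define v where "v i = multiplicity p (a i)" for i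
    define z where "z = last_digit p (a undefined)"
    define w where "w \<alpha> = (\<Sum>i\<in>UNIV. v i * Poly_Mapping.lookup \<alpha> i)" for \<alpha>
    define J where "J = {\<alpha>. \<alpha> \<in> ?K \<and> (\<forall>\<beta>\<in>?K. w \<alpha> \<le> w \<beta>)}"
    have "0 < a i" for i
      using a \<open>C \<in> \<C>\<close> \<C>(2) by (auto simp: partition_on_def)
    then have z: "\<not> [int z = 0] (mod int p)"
      unfolding z_def by (intro last_digit_not_cong_0 prime)
    have same: "colour (a i) = colour (a j)" for i j
      using mono \<open>C \<in> \<C>\<close> a by blast
    have "[(\<Sum>\<alpha>\<in>J. Poly_Mapping.lookup P \<alpha> * int z ^ total_degree \<alpha>) = 0] (mod int p)"
      unfolding J_def w_def v_def
      by (rule eval_mpoly_leading_terms)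
        (use prime zero same in \<open>auto simp: z_def colour_def\<close>)
    then have J_zero: "\<exists>z. \<not> [z = 0] (mod int p) \<and>
        [(\<Sum>\<alpha>\<in>J. Poly_Mapping.lookup P \<alpha> * z ^ total_degree \<alpha>) = 0] (mod int p)"
      using z by blast
    show False
    proof (cases "v undefined = 0")
      case True
      then have "v i = 0" for i
        using same[of i undefined] by (simp add: v_def colour_def)
      \<comment> \<open>All weights are 0, so every term is a leading term.\<close>
      then have K: "J = ?K"
        by (simp add: J_def w_def)
      show False
        using cond1 J_zero unfolding K by blast
    next
      case False
      then have pos: "0 < v i" for i
        using same[of i undefined] by (simp add: v_def colour_def)
      \<comment> \<open>For empty support the sum in \<open>cond1\<close> would be 0, and
        \<open>z\<close> would solve the congruence.\<close>
      have "?K \<noteq> {}"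
        using cond1 z by auto
      then have "Min (w ` ?K) \<in> w ` ?K"
        by simp
      then obtain \<alpha> where "\<alpha> \<in> ?K" "w \<alpha> = Min (w ` ?K)"
        by force
      then have "J \<noteq> {}"
        by (auto simp: J_def)
      moreover have "\<exists>\<Lambda>. \<Lambda> \<noteq> {} \<and>
          (\<Sum>i\<in>\<Lambda>. Poly_Mapping.lookup \<alpha> i) = (\<Sum>i\<in>\<Lambda>. Poly_Mapping.lookup \<beta> i)"
        if "\<alpha> \<in> J" "\<beta> \<in> J" for \<alpha> \<beta>
      proof (rule Rado_relation[OF q pos])
        show "last_digit q (v i) = last_digit q (v j)" for i j
          using same[of i j] by (simp add: v_def colour_def)
        \<comment> \<open>Both indexes attain the least weight, and this coincidence is the linear
          relation in the \<open>v i\<close>.\<close>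
        show "(\<Sum>i\<in>UNIV. v i * Poly_Mapping.lookup \<alpha> i) = (\<Sum>i\<in>UNIV. v i * Poly_Mapping.lookup \<beta> i)"
          using that unfolding w_def[symmetric] by (intro le_antisym) (simp_all add: J_def)
        show "(\<Sum>i\<in>UNIV. Poly_Mapping.lookup \<alpha> i) < q" "(\<Sum>i\<in>UNIV. Poly_Mapping.lookup \<beta> i) < q"
          using that by (intro small; simp add: J_def)+
      qed
      moreover have "minimal_index P \<alpha>" if "\<alpha> \<in> J" for \<alpha>
      proof -
        have "\<not> index_less \<beta> \<alpha>" if "\<beta> \<in> ?K" for \<beta>
        proof
          assume "index_less \<beta> \<alpha>"
          then have "w \<beta> < w \<alpha>"
            unfolding w_def by (rule index_less_weighted_sum[OF _ pos])
          moreover have "w \<alpha> \<le> w \<beta>"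
            using \<open>\<alpha> \<in> J\<close> that by (simp add: J_def)
          ultimately show False
            by simp
        qed
        then show ?thesis
          using that by (simp add: minimal_index_def J_def)
      qed
      ultimately have "minimal_Rado_set P J"
        unfolding minimal_Rado_set_def Rado_set_def by (intro conjI ballI) (auto simp: J_def)
      then show False
        using cond2 J_zero by blast
    qed
  qed
  then show ?thesis
    using \<C> by blast
qed

end
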